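(* Let $\alpha$ be a nonzero real number, let $j$ be the imaginary unit ($j^2=-1$), let $\mathbf{I}$ be the $2\times 2$ identity matrix, and let $$\mathbf{\Phi} = \begin{pmatrix} 0 & j \\ j\alpha^2 & 0 \end{pmatrix}.$$ Then for every real number $\varphi$, $$e^{\varphi \mathbf{\Phi}} = \cos(\alpha\varphi)\,\mathbf{I} + \frac{1}{\alpha}\sin(\alpha\varphi)\,\mathbf{\Phi}.$$
   Context: For a square complex matrix $\mathbf{A}$, the matrix exponential is $e^{\mathbf{A}} = \sum_{n=0}^{+\infty} \frac{\mathbf{A}^n}{n!}$. *)

theory Defs
  imports "HOL-Analysis.Analysis"
begin

(* On the vector type, multiplication (and hence the power operator) is componentwise, so
   neither the library's power nor its exp gives the matrix notion; powers are taken here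
   with respect to the matrix product. *)
primrec matrix_power :: "complex^'n^'n \<Rightarrow> nat \<Rightarrow> complex^'n^'n" where
  "matrix_power A 0 = mat 1"
| "matrix_power A (Suc n) = A ** matrix_power A n"

(* The series converges for every A, see matrix_exp_summable and matrix_exp_sums below. *)
definition matrix_exp :: "complex^'n^'n \<Rightarrow> complex^'n^'n" where
  "matrix_exp A = (\<Sum>n. matrix_power A n /\<^sub>R fact n)"

definition Phi :: "real \<Rightarrow> complex^2^2" where
  "Phi \<alpha> = vector [vector [0, \<i>],
                    vector [\<i> * (complex_of_real \<alpha>)\<^sup>2, 0]]"

lemma matrix_power_entry_le:
  fixes A :: "complex^'n^'n"
  shows "cmod (matrix_power A n $ i $ k) \<le> (\<Sum>a\<in>UNIV. \<Sum>b\<in>UNIV. cmod (A $ a $ b)) ^ n"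
proof (induction n arbitrary: i k)
  case 0
  show ?case by (simp add: mat_def)
next
  case (Suc n)
  let ?K = "\<Sum>a\<in>UNIV. \<Sum>b\<in>UNIV. cmod (A $ a $ b)"
  have "cmod (matrix_power A (Suc n) $ i $ k)
      \<le> (\<Sum>l\<in>UNIV. cmod (A $ i $ l * matrix_power A n $ l $ k))"
    by (simp add: matrix_matrix_mult_def norm_sum)
  also have "\<dots> \<le> (\<Sum>l\<in>UNIV. cmod (A $ i $ l) * ?K ^ n)"
    by (intro sum_mono) (simp add: norm_mult mult_left_mono Suc.IH)
  also have "\<dots> = (\<Sum>l\<in>UNIV. cmod (A $ i $ l)) * ?K ^ n"
    by (simp add: sum_distrib_right)
  also have "\<dots> \<le> ?K * ?K ^ n"
    by (intro mult_right_mono member_le_sum[where f = "\<lambda>a. \<Sum>b\<in>UNIV. cmod (A $ a $ b)"]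
          zero_le_power sum_nonneg) auto
  finally show ?case by simp
qed

lemma matrix_exp_summable: "summable (\<lambda>n. matrix_power A n /\<^sub>R fact n)"
  for A :: "complex^'n^'n"
proof -
  let ?K = "\<Sum>a\<in>UNIV. \<Sum>b\<in>UNIV. cmod (A $ a $ b)"
  let ?f = "\<lambda>n. matrix_power A n /\<^sub>R fact n"
  have s: "summable (\<lambda>n. ?f n $ i $ k)" for i k
  proof (rule summable_comparison_test'[OF summable_exp[of ?K], of 0])
    show "norm (?f n $ i $ k) \<le> inverse (fact n) * ?K ^ n" for n
      using matrix_power_entry_le[of A n i k] by (simp add: mult_left_mono)
  qed
  have "?f sums (\<chi> i k. \<Sum>n. ?f n $ i $ k)"
    unfolding sums_def
    by (intro vec_tendstoI) (use s in \<open>simp add: summable_sums[unfolded sums_def]\<close>)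
  then show ?thesis by (rule sums_summable)
qed

lemma matrix_exp_sums: "(\<lambda>n. matrix_power A n /\<^sub>R fact n) sums matrix_exp A"
  unfolding matrix_exp_def by (rule summable_sums[OF matrix_exp_summable])

end

theory Submission
  imports Defs
begin

text \<open>
  The matrix \<open>\<Phi>\<close> behaves like \<open>\<alpha>\<close> times an imaginary unit: its square is \<open>-\<alpha>\<^sup>2\<close> times
  the identity (\<open>Phi_square\<close>). Hence the claim is Euler's formula
  \<open>exp (\<theta> J) = cos \<theta> + sin \<theta> J\<close> for \<open>\<theta> = \<alpha> \<phi>\<close> and \<open>J = \<Phi> / \<alpha>\<close> with \<open>J\<^sup>2 = -1\<close>.
  Euler's formula depends only on this relation, and it is proved here for matrices of any
  size (\<open>matrix_exp_Euler\<close>): the relation reduces every power of \<open>\<phi> \<Phi>\<close> to a combination of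
  the identity and \<open>\<Phi>\<close>, the coefficients in the exponential series are the Taylor terms of
  cosine and sine (\<open>matrix_exp_term_Euler\<close>), and the two real series can be summed separately.
\<close>

lemma scaleR_matrix_mult:
  fixes A B :: "complex^'n^'n"
  shows "(c *\<^sub>R A) ** B = c *\<^sub>R (A ** B)" and "A ** (c *\<^sub>R B) = c *\<^sub>R (A ** B)"
  by (simp_all add: vec_eq_iff matrix_matrix_mult_def scaleR_sum_right)

text \<open>
  The induction works because left multiplication by \<open>t B\<close>, together with division by
  \<open>n + 1\<close>, sends the identity to a multiple of \<open>B\<close> and \<open>B\<close> to a negative multiple of the
  identity, which is how the coefficients of sine and cosine determine one another. The scalar
  \<open>t\<close> is kept apart from \<open>B\<close> so that the formula includes \<open>t = 0\<close>, while the division is by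
  \<open>\<omega>\<close> alone.
\<close>
lemma matrix_exp_term_Euler:
  fixes B :: "complex^'n^'n" and \<omega> t :: real
  assumes "\<omega> \<noteq> 0" and sq: "B ** B = - (\<omega>\<^sup>2) *\<^sub>R mat 1"
  shows "matrix_power (t *\<^sub>R B) n /\<^sub>R fact n =
         (cos_coeff n *\<^sub>R (\<omega> * t) ^ n) *\<^sub>R mat 1 +
         (1 / \<omega> * (sin_coeff n *\<^sub>R (\<omega> * t) ^ n)) *\<^sub>R B"
proof (induction n)
  case 0
  show ?case by (simp add: cos_coeff_def sin_coeff_def)
next
  case (Suc n)
  define c where "c = cos_coeff n * (\<omega> * t) ^ n"
  define s where "s = sin_coeff n * (\<omega> * t) ^ n"
  have "matrix_power (t *\<^sub>R B) (Suc n) /\<^sub>R fact (Suc n) =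
        (t / Suc n) *\<^sub>R (B ** (matrix_power (t *\<^sub>R B) n /\<^sub>R fact n))"
    by (simp add: scaleR_matrix_mult field_simps)
  also have "\<dots> = (t / Suc n) *\<^sub>R (B ** (c *\<^sub>R mat 1 + (s / \<omega>) *\<^sub>R B))"
    unfolding Suc.IH c_def s_def by simp
  also have "\<dots> = (t / Suc n) *\<^sub>R (c *\<^sub>R B - (\<omega> * s) *\<^sub>R mat 1)"
    using \<open>\<omega> \<noteq> 0\<close>
    by (simp add: matrix_add_ldistrib scaleR_matrix_mult sq power2_eq_square mult.commute)
  also have "\<dots> = (- s * \<omega> * t / Suc n) *\<^sub>R mat 1 + (1 / \<omega> * (c * \<omega> * t / Suc n)) *\<^sub>R B"
    using \<open>\<omega> \<noteq> 0\<close> by (simp add: scaleR_diff_right mult_ac)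
  also have "- s * \<omega> * t / Suc n = cos_coeff (Suc n) *\<^sub>R (\<omega> * t) ^ Suc n"
    by (simp add: s_def cos_coeff_Suc mult_ac)
  also have "c * \<omega> * t / Suc n = sin_coeff (Suc n) *\<^sub>R (\<omega> * t) ^ Suc n"
    by (simp add: c_def sin_coeff_Suc mult_ac)
  finally show ?case .
qed

lemma matrix_exp_Euler:
  fixes B :: "complex^'n^'n" and \<omega> t :: real
  assumes "\<omega> \<noteq> 0" and "B ** B = - (\<omega>\<^sup>2) *\<^sub>R mat 1"
  shows "matrix_exp (t *\<^sub>R B) =
         cos (\<omega> * t) *\<^sub>R mat 1 + (1 / \<omega> * sin (\<omega> * t)) *\<^sub>R B"
proof -
  have "(\<lambda>n. matrix_power (t *\<^sub>R B) n /\<^sub>R fact n) sums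
        (cos (\<omega> * t) *\<^sub>R mat 1 + (1 / \<omega> * sin (\<omega> * t)) *\<^sub>R B)"
    unfolding matrix_exp_term_Euler[OF assms]
    by (intro sums_add sums_scaleR_left sums_mult cos_converges sin_converges)
  then show ?thesis
    using matrix_exp_sums sums_unique2 by blast
qed

lemma Phi_square: "Phi \<alpha> ** Phi \<alpha> = - (\<alpha>\<^sup>2) *\<^sub>R mat 1"
  by (simp add: Phi_def vec_eq_iff forall_2 matrix_matrix_mult_def sum_2 mat_def)
    (simp add: scaleR_conv_of_real mult.commute[of "\<i> * (complex_of_real \<alpha>)\<^sup>2" \<i>] flip: mult.assoc)

theorem theorem1:
  fixes \<alpha> \<phi> :: real
  assumes "\<alpha> \<noteq> 0"
  shows "matrix_exp (\<phi> *\<^sub>R Phi \<alpha>) =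
         cos (\<alpha> * \<phi>) *\<^sub>R mat 1 + (1 / \<alpha> * sin (\<alpha> * \<phi>)) *\<^sub>R Phi \<alpha>"
  using assms Phi_square by (rule matrix_exp_Euler)

end
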